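(* For each $n\in\{1,2,3,4\}$, the set $n$-Sierpinski, $\bigcup_{j=0}^{n-1}\bigl(S+(j,0)\bigr)$, where $S$ is the Sierpinski gasket, is the attractor of some contractive IFS consisting of similitudes.
   Context: A similitude is a map $f:\mathbb{R}^2\to\mathbb{R}^2$ for which there exist $\theta\in[0,2\pi)$, $k\in(0,+\infty)$ and $x_0,y_0\in\mathbb{R}$ such that $f\binom{x}{y}=k\begin{pmatrix}\cos\theta&-\sin\theta\\ \sin\theta&\cos\theta\end{pmatrix}\binom{x}{y}+\binom{x_0}{y_0}$ or $f\binom{x}{y}=k\begin{pmatrix}\cos\theta&\sin\theta\\ \sin\theta&-\cos\theta\end{pmatrix}\binom{x}{y}+\binom{x_0}{y_0}$; $k$ is its scaling factor, and $f$ is contractive if $k<1$. A contractive IFS consisting of similitudes is a finite family $\{\mathbb{R}^2;f_1,\dots,f_N\}$ of contractive similitudes; its attractor is the unique nonempty compact set $A\subset\mathbb{R}^2$ with $A=f_1(A)\cup\cdots\cup f_N(A)$. The Sierpinski gasket $S\subset\mathbb{R}^2$ is the attractor of the IFS consisting of $p\mapsto\frac12p$, $p\mapsto\frac12p+(\frac14,\frac{\sqrt3}{4})$, $p\mapsto\frac12p+(\frac12,0)$. For $n=1$ the set above is $S$ itself. *)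

theory Defs
  imports "HOL-Analysis.Analysis"
begin

definition rotation_matrix :: "real \<Rightarrow> real^2^2" where
  "rotation_matrix \<theta> = vector [vector [cos \<theta>, - sin \<theta>], vector [sin \<theta>, cos \<theta>]]"

definition reflection_matrix :: "real \<Rightarrow> real^2^2" where
  "reflection_matrix \<theta> = vector [vector [cos \<theta>, sin \<theta>], vector [sin \<theta>, - cos \<theta>]]"

definition similitude_with_factor :: "real \<Rightarrow> (real^2 \<Rightarrow> real^2) \<Rightarrow> bool" where
  "similitude_with_factor k f \<longleftrightarrow> k > 0 \<and>
     (\<exists>\<theta> \<in> {0..<2 * pi}. \<exists>x0 y0.
        f = (\<lambda>p. k *\<^sub>R (rotation_matrix \<theta> *v p) + vector [x0, y0]) \<or>
        f = (\<lambda>p. k *\<^sub>R (reflection_matrix \<theta> *v p) + vector [x0, y0]))"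

definition contractive_similitude :: "(real^2 \<Rightarrow> real^2) \<Rightarrow> bool" where
  "contractive_similitude f \<longleftrightarrow> (\<exists>k<1. similitude_with_factor k f)"

definition contractive_similitude_ifs :: "(real^2 \<Rightarrow> real^2) list \<Rightarrow> bool" where
  "contractive_similitude_ifs fs \<longleftrightarrow> fs \<noteq> [] \<and> (\<forall>f \<in> set fs. contractive_similitude f)"

definition compact_invariant :: "(real^2 \<Rightarrow> real^2) list \<Rightarrow> (real^2) set \<Rightarrow> bool" where
  "compact_invariant fs A \<longleftrightarrow> A \<noteq> {} \<and> compact A \<and> A = (\<Union>f \<in> set fs. f ` A)"

definition is_attractor :: "(real^2 \<Rightarrow> real^2) list \<Rightarrow> (real^2) set \<Rightarrow> bool" where
  "is_attractor fs A \<longleftrightarrow> compact_invariant fs A \<and> (\<forall>B. compact_invariant fs B \<longrightarrow> B = A)"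

(* Only meaningful when an attractor exists, as it does for every contractive IFS. *)
definition attractor :: "(real^2 \<Rightarrow> real^2) list \<Rightarrow> (real^2) set" where
  "attractor fs = (THE A. is_attractor fs A)"

definition sierpinski_ifs :: "(real^2 \<Rightarrow> real^2) list" where
  "sierpinski_ifs =
     [\<lambda>p. (1/2) *\<^sub>R p,
      \<lambda>p. (1/2) *\<^sub>R p + vector [1/4, sqrt 3 / 4],
      \<lambda>p. (1/2) *\<^sub>R p + vector [1/2, 0]]"

definition sierpinski_gasket :: "(real^2) set" where
  "sierpinski_gasket = attractor sierpinski_ifs"

definition n_sierpinski :: "nat \<Rightarrow> (real^2) set" where
  "n_sierpinski n = (\<Union>j<n. (\<lambda>p. p + vector [real j, 0]) ` sierpinski_gasket)"

end

theory Submission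
  imports Defs
begin

text \<open>
  Write \<open>G\<close> for the gasket, \<open>T\<close> for the union of its \<open>n\<close> horizontal translates, and \<open>\<rho>\<close> for the
  rotation by \<open>2\<pi>/3\<close> that permutes the vertices of \<open>G\<close> cyclically. The idea is to build \<open>G\<close>, and
  hence each of its translates, from three rotated copies of one shrunken \<open>T\<close>:
  \<open>G = P \<union> \<rho>(P) \<union> \<rho>\<^sup>2(P)\<close> with \<open>P = T/m\<close>, where \<open>m = 2\<close> if \<open>n \<le> 2\<close> and \<open>m = 4\<close> if \<open>n\<close> is
  \<open>3\<close> or \<open>4\<close>. Indeed \<open>P\<close> is then a row of \<open>n\<close> cells of size \<open>1/m\<close> along the bottom edge of \<open>G\<close>,
  starting at the left corner. At both scales every cell has a side on one of the three edges
  of \<open>G\<close>, and as soon as the row contains all cells of the edge except possibly the last one, its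
  three rotations reach all of them (\<open>gasket_from_strips\<close>). At the next scale, \<open>m = 8\<close>, some cells
  lie strictly inside \<open>G\<close>, which is why this covering stops at four translates.

  The \<open>3n\<close> maps \<open>p \<mapsto> \<rho>\<^sup>k(p/m) + (j, 0)\<close> thus leave \<open>T\<close> invariant. What remains is soft:
  a finite family of contractions has at most one nonempty compact invariant set, which turns
  invariance into being the attractor, and which also yields \<open>\<rho>(G) = G\<close>, because \<open>\<rho>\<close> conjugates
  the maps defining \<open>G\<close> into one another.
\<close>

section \<open>Invariant sets of contractions\<close>

text \<open>
  The point of \<open>A\<close> farthest from \<open>B\<close> is the image of some point of \<open>A\<close> under one of the maps, and
  this map shrinks the distance to \<open>B\<close>; so the largest distance is zero.
\<close>

lemma invariant_subset:
  fixes A B :: "'a::heine_borel set"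
  assumes contr: "\<And>f. f \<in> F \<Longrightarrow> \<exists>c<1. \<forall>x y. dist (f x) (f y) \<le> c * dist x y"
    and A: "compact A" "A \<subseteq> (\<Union>f\<in>F. f ` A)"
    and B: "compact B" "B \<noteq> {}" "(\<Union>f\<in>F. f ` B) \<subseteq> B"
  shows "A \<subseteq> B"
proof (cases "A = {}")
  case False
  have "continuous_on A (\<lambda>x. infdist x B)"
    by (intro continuous_intros)
  then obtain a where a: "a \<in> A" and max: "\<And>x. x \<in> A \<Longrightarrow> infdist x B \<le> infdist a B"
    using continuous_attains_sup[OF A(1) False] by blast
  obtain f a' where f: "f \<in> F" and a': "a' \<in> A" and eq: "a = f a'"
    using a A(2) by blast
  obtain c where c: "c < 1" and lip: "\<And>x y. dist (f x) (f y) \<le> c * dist x y"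
    using contr[OF f] by blast
  obtain b' where b': "b' \<in> B" and near: "infdist a' B = dist a' b'"
    using infdist_attains_inf[OF compact_imp_closed[OF B(1)] B(2)] by blast
  have "f b' \<in> B"
    using B(3) b' f by blast
  then have le: "infdist a B \<le> c * infdist a' B"
    using infdist_le[of "f b'" B "f a'"] lip[of a' b'] eq near by simp
  have "infdist a B \<le> 0"
  proof (rule ccontr)
    assume pos: "\<not> infdist a B \<le> 0"
    then have "infdist a' B > 0"
      using le max[OF a'] infdist_nonneg[of a' B] by (cases "infdist a' B = 0") auto
    then have "c * infdist a' B < infdist a' B"
      using c by simp
    then show False
      using le max[OF a'] by simp
  qed
  then have zero: "infdist x B = 0" if "x \<in> A" for x
    using max[OF that] infdist_nonneg[of x B] by linarith
  then show ?thesis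
    using in_closed_iff_infdist_zero[OF compact_imp_closed[OF B(1)] B(2)] by blast
qed simp

lemma closure_finite_UN:
  "finite I \<Longrightarrow> closure (\<Union>i\<in>I. A i) = (\<Union>i\<in>I. closure (A i))"
  by (induction I rule: finite_induct) simp_all

inductive_set orbit :: "('a \<Rightarrow> 'a) set \<Rightarrow> 'a \<Rightarrow> 'a set" for F x where
  start: "x \<in> orbit F x"
| step: "p \<in> orbit F x \<Longrightarrow> f \<in> F \<Longrightarrow> f p \<in> orbit F x"

text \<open>
  Starting at a fixed point of one of the maps makes the orbit itself invariant, as the starting
  point is then again an image. The closure inherits this, since continuous images of a compact
  closure are closures of images.
\<close>

lemma invariant_closure_orbit:
  fixes x :: "'a::heine_borel"
  assumes "finite F"
    and cont: "\<And>f. f \<in> F \<Longrightarrow> continuous_on UNIV f"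
    and g: "g \<in> F" "g x = x"
    and bdd: "bounded (orbit F x)"
  shows "closure (orbit F x) = (\<Union>f\<in>F. f ` closure (orbit F x))"
proof -
  have orb: "orbit F x = (\<Union>f\<in>F. f ` orbit F x)"
  proof
    show "orbit F x \<subseteq> (\<Union>f\<in>F. f ` orbit F x)"
    proof
      fix p assume "p \<in> orbit F x"
      then show "p \<in> (\<Union>f\<in>F. f ` orbit F x)"
      proof cases
        case start
        then show ?thesis
          using g orbit.start[of x F] image_eqI[of x g x "orbit F x"] by auto
      qed blast
    qed
    show "(\<Union>f\<in>F. f ` orbit F x) \<subseteq> orbit F x"
      by (auto intro: orbit.step)
  qed
  have im: "f ` closure (orbit F x) = closure (f ` orbit F x)" if "f \<in> F" for f
  proof
    have sub: "continuous_on (closure (orbit F x)) f"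
      using cont[OF that] continuous_on_subset by blast
    then show "f ` closure (orbit F x) \<subseteq> closure (f ` orbit F x)"
      by (intro image_closure_subset) (auto intro: closure_subset[THEN subsetD])
    have "compact (f ` closure (orbit F x))"
      using sub bdd by (intro compact_continuous_image) (auto simp: compact_closure)
    then show "closure (f ` orbit F x) \<subseteq> f ` closure (orbit F x)"
      by (intro closure_minimal image_mono closure_subset compact_imp_closed)
  qed
  have "closure (orbit F x) = closure (\<Union>f\<in>F. f ` orbit F x)"
    using orb by simp
  also have "\<dots> = (\<Union>f\<in>F. closure (f ` orbit F x))"
    using \<open>finite F\<close> by (rule closure_finite_UN)
  finally show ?thesis
    using im by simp
qed

section \<open>Similitudes\<close>

lemma rotation_matrix_vector:
  "rotation_matrix \<theta> *v p = vector [cos \<theta> * p$1 - sin \<theta> * p$2, sin \<theta> * p$1 + cos \<theta> * p$2]"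
  by (simp add: rotation_matrix_def vec_eq_iff forall_2 matrix_vector_mult_def sum_2)

lemma reflection_matrix_vector:
  "reflection_matrix \<theta> *v p = vector [cos \<theta> * p$1 + sin \<theta> * p$2, sin \<theta> * p$1 - cos \<theta> * p$2]"
  by (simp add: reflection_matrix_def vec_eq_iff forall_2 matrix_vector_mult_def sum_2)

lemma norm_vec2: "norm (p :: real^2) = sqrt ((p$1)\<^sup>2 + (p$2)\<^sup>2)"
  by (simp add: norm_vec_def L2_set_def sum_2)

lemma norm_rotation: "norm (rotation_matrix \<theta> *v p) = norm p"
proof -
  have "(cos \<theta> * x - sin \<theta> * y)\<^sup>2 + (sin \<theta> * x + cos \<theta> * y)\<^sup>2
      = ((sin \<theta>)\<^sup>2 + (cos \<theta>)\<^sup>2) * (x\<^sup>2 + y\<^sup>2)" for x y :: real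
    by algebra
  then show ?thesis
    by (simp add: norm_vec2 rotation_matrix_vector)
qed

lemma norm_reflection: "norm (reflection_matrix \<theta> *v p) = norm p"
proof -
  have "(cos \<theta> * x + sin \<theta> * y)\<^sup>2 + (sin \<theta> * x - cos \<theta> * y)\<^sup>2
      = ((sin \<theta>)\<^sup>2 + (cos \<theta>)\<^sup>2) * (x\<^sup>2 + y\<^sup>2)" for x y :: real
    by algebra
  then show ?thesis
    by (simp add: norm_vec2 reflection_matrix_vector)
qed

lemma similitude_dist:
  assumes "similitude_with_factor k f"
  shows "dist (f p) (f q) = k * dist p q"
proof -
  obtain M v where "k > 0" and f: "f = (\<lambda>p. k *\<^sub>R (M *v p) + v)"
    and iso: "\<And>p. norm (M *v p) = norm p"
    using assms norm_rotation norm_reflection unfolding similitude_with_factor_def by blast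
  have "f p - f q = k *\<^sub>R (M *v (p - q))"
    by (simp add: f matrix_vector_mult_diff_distrib scaleR_diff_right)
  then show ?thesis
    using iso[of "p - q"] \<open>k > 0\<close> by (simp add: dist_norm)
qed

lemma rotation_similitude:
  assumes "0 < k" "k < 1" "0 \<le> \<theta>" "\<theta> < 2 * pi"
  shows "contractive_similitude (\<lambda>p. k *\<^sub>R (rotation_matrix \<theta> *v p) + v)"
proof -
  have "v = vector [v$1, v$2]"
    by (simp add: vec_eq_iff forall_2)
  then have "similitude_with_factor k (\<lambda>p. k *\<^sub>R (rotation_matrix \<theta> *v p) + v)"
    using assms unfolding similitude_with_factor_def
    by (intro conjI bexI[of _ \<theta>] exI[of _ "v$1"] exI[of _ "v$2"] disjI1) simp_all
  then show ?thesis
    using assms contractive_similitude_def by blast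
qed

lemma compact_invariant_unique:
  assumes fs: "contractive_similitude_ifs fs"
    and "compact_invariant fs A" "compact_invariant fs B"
  shows "A = B"
proof -
  have contr: "\<exists>c<1. \<forall>x y. dist (f x) (f y) \<le> c * dist x y" if "f \<in> set fs" for f
  proof -
    have "contractive_similitude f"
      using fs that by (simp add: contractive_similitude_ifs_def)
    then obtain k where "k < 1" and k: "similitude_with_factor k f"
      by (auto simp: contractive_similitude_def)
    moreover have "\<forall>x y. dist (f x) (f y) \<le> k * dist x y"
      by (simp add: similitude_dist[OF k])
    ultimately show ?thesis
      by blast
  qed
  have "X \<subseteq> Y" if X: "compact_invariant fs X" and Y: "compact_invariant fs Y" for X Y
  proof (rule invariant_subset[OF contr])
    show "compact X" "X \<subseteq> (\<Union>f\<in>set fs. f ` X)"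
      using X equalityD1 unfolding compact_invariant_def by blast+
    show "compact Y" "Y \<noteq> {}" "(\<Union>f\<in>set fs. f ` Y) \<subseteq> Y"
      using Y equalityD2 unfolding compact_invariant_def by blast+
  qed
  then show ?thesis
    using assms by blast
qed

lemma is_attractor_iff:
  assumes "contractive_similitude_ifs fs"
  shows "is_attractor fs A \<longleftrightarrow> compact_invariant fs A"
  using compact_invariant_unique[OF assms] unfolding is_attractor_def by blast

section \<open>The gasket and its threefold symmetry\<close>

definition right_vertex :: "real^2" where
  "right_vertex = vector [1, 0]"

definition top_vertex :: "real^2" where
  "top_vertex = vector [1/2, sqrt 3 / 2]"

definition halfway :: "real^2 \<Rightarrow> real^2 \<Rightarrow> real^2" where
  "halfway v p = (1/2) *\<^sub>R (p + v)"

lemma set_sierpinski_ifs: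
  "set sierpinski_ifs = {halfway 0, halfway right_vertex, halfway top_vertex}"
proof -
  have "(\<lambda>p. (1/2) *\<^sub>R p) = halfway 0"
    "(\<lambda>p. (1/2) *\<^sub>R p + vector [1/4, sqrt 3 / 4]) = halfway top_vertex"
    "(\<lambda>p. (1/2) *\<^sub>R p + vector [1/2, 0]) = halfway right_vertex"
    by (auto simp: fun_eq_iff halfway_def right_vertex_def top_vertex_def vec_eq_iff forall_2
        algebra_simps)
  then show ?thesis
    by (auto simp: sierpinski_ifs_def)
qed

lemma contractive_sierpinski_ifs: "contractive_similitude_ifs sierpinski_ifs"
proof -
  have "halfway v = (\<lambda>p. (1/2) *\<^sub>R (rotation_matrix 0 *v p) + (1/2) *\<^sub>R v)" for v
    by (simp add: fun_eq_iff halfway_def rotation_matrix_vector vec_eq_iff forall_2 algebra_simps)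
  then have "contractive_similitude (halfway v)" for v
    using rotation_similitude[of "1/2" 0 "(1/2) *\<^sub>R v"] by simp
  then show ?thesis
    unfolding contractive_similitude_ifs_def set_sierpinski_ifs
    by (auto simp: sierpinski_ifs_def)
qed

text \<open>The unit disc contains the orbit of the origin, which is fixed by the first map.\<close>

lemma ex_compact_invariant_sierpinski: "\<exists>A. compact_invariant sierpinski_ifs A"
proof -
  let ?F = "set sierpinski_ifs"
  have "norm right_vertex = 1" "norm top_vertex = 1"
    by (simp_all add: norm_vec2 right_vertex_def top_vertex_def power_divide)
  then have unit: "\<exists>v. norm v \<le> 1 \<and> f = halfway v" if "f \<in> ?F" for f
    using that norm_zero unfolding set_sierpinski_ifs
    by (metis empty_iff insertE order_refl zero_le_one)
  have disc: "norm p \<le> 1" if "p \<in> orbit ?F 0" for p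
    using that
  proof induction
    case (step p f)
    then obtain v where v: "norm v \<le> 1" "f = halfway v"
      using unit by blast
    then show ?case
      using step norm_triangle_ineq[of p v] by (simp add: halfway_def)
  qed simp
  then have bdd: "bounded (orbit ?F 0)"
    unfolding bounded_iff by blast
  have "closure (orbit ?F 0) = (\<Union>f\<in>?F. f ` closure (orbit ?F 0))"
  proof (rule invariant_closure_orbit[OF _ _ _ _ bdd])
    show "continuous_on UNIV f" if "f \<in> ?F" for f
      using unit[OF that] by (auto simp: halfway_def[abs_def] intro!: continuous_intros)
    show "halfway 0 \<in> ?F" "halfway 0 0 = 0"
      by (auto simp: set_sierpinski_ifs halfway_def)
  qed simp
  then show ?thesis
    using bdd orbit.start[of 0 ?F] unfolding compact_invariant_def
    by (intro exI[of _ "closure (orbit ?F 0)"]) (auto simp: compact_closure)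
qed

lemma compact_invariant_gasket: "compact_invariant sierpinski_ifs sierpinski_gasket"
proof -
  obtain A where A: "compact_invariant sierpinski_ifs A"
    using ex_compact_invariant_sierpinski ..
  then have "is_attractor sierpinski_ifs A"
    using is_attractor_iff[OF contractive_sierpinski_ifs] by blast
  then have "sierpinski_gasket = A"
    unfolding sierpinski_gasket_def attractor_def
    by (rule the_equality)
      (rule compact_invariant_unique[OF contractive_sierpinski_ifs _ A], simp add: is_attractor_def)
  then show ?thesis
    using A by simp
qed

lemma gasket_decomposition:
  "sierpinski_gasket = halfway 0 ` sierpinski_gasket \<union> halfway right_vertex ` sierpinski_gasket
    \<union> halfway top_vertex ` sierpinski_gasket"
proof -
  have "(\<Union>f\<in>set sierpinski_ifs. f ` X)
      = halfway 0 ` X \<union> halfway right_vertex ` X \<union> halfway top_vertex ` X" for X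
    by (simp add: set_sierpinski_ifs Un_assoc)
  then show ?thesis
    using compact_invariant_gasket unfolding compact_invariant_def by metis
qed

definition turn :: "real^2 \<Rightarrow> real^2" where
  "turn p = rotation_matrix (2 * pi / 3) *v p + right_vertex"

lemma turn_vector:
  "turn p = vector [1 - p$1 / 2 - sqrt 3 / 2 * p$2, sqrt 3 / 2 * p$1 - p$2 / 2]"
  using cos_120 sin_120
  by (simp add: turn_def rotation_matrix_vector right_vertex_def vec_eq_iff forall_2)

lemma turn_vertices:
  "turn 0 = right_vertex" "turn right_vertex = top_vertex" "turn top_vertex = 0"
  by (simp_all add: turn_vector right_vertex_def top_vertex_def vec_eq_iff forall_2)

lemma turn_halfway: "turn (halfway v p) = halfway (turn v) (turn p)"
  by (simp add: turn_vector halfway_def vec_eq_iff forall_2 field_simps)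

lemma turn_halfway_image: "turn ` halfway v ` X = halfway (turn v) ` turn ` X"
  by (simp add: image_image turn_halfway)

text \<open>
  Conjugation by the rotation permutes the three maps defining the gasket, so the rotated gasket is
  invariant under the same maps and uniqueness applies.
\<close>

lemma turn_gasket: "turn ` sierpinski_gasket = sierpinski_gasket"
proof -
  let ?G = sierpinski_gasket
  have "turn ` ?G = turn ` (halfway 0 ` ?G \<union> halfway right_vertex ` ?G \<union> halfway top_vertex ` ?G)"
    using gasket_decomposition by simp
  also have "\<dots> = (\<Union>f\<in>set sierpinski_ifs. f ` turn ` ?G)"
    unfolding image_Un turn_halfway_image turn_vertices set_sierpinski_ifs by (simp add: Un_ac)
  finally have "turn ` ?G = (\<Union>f\<in>set sierpinski_ifs. f ` turn ` ?G)" .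
  moreover have "continuous_on ?G turn"
    unfolding turn_def[abs_def]
    by (intro continuous_intros linear_continuous_on_compose[OF continuous_on_id])
      (simp_all add: matrix_vector_mul_linear)
  ultimately have "compact_invariant sierpinski_ifs (turn ` ?G)"
    using compact_invariant_gasket compact_continuous_image
    unfolding compact_invariant_def by blast
  then show ?thesis
    using compact_invariant_unique[OF contractive_sierpinski_ifs] compact_invariant_gasket by blast
qed

section \<open>The gasket from three rotated rows\<close>

text \<open>
  The cells of size \<open>1/2\<close> are named by the vertices \<open>0, R, T\<close> of the gasket, those of size \<open>1/4\<close> by
  pairs of vertices. The rotation acts on names by \<open>0 \<mapsto> R \<mapsto> T \<mapsto> 0\<close>. For scale \<open>1/2\<close> the single
  cell \<open>0\<close> already has all three cells in its orbit. For scale \<open>1/4\<close> the row of three consists of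
  \<open>00\<close>, \<open>0R\<close> and \<open>R0\<close>, whose orbits partition the nine cells. A further cell \<open>R\<close>, respectively
  \<open>RR\<close>, only repeats cells already reached.
\<close>

lemma gasket_from_strips:
  assumes "n \<in> {1, 2, 3, 4}"
  obtains s :: real where "0 < s" "s < 1"
    and "sierpinski_gasket = (\<Union>k<3. (turn ^^ k) ` (*\<^sub>R) s ` n_sierpinski n)"
proof -
  let ?G = sierpinski_gasket and ?R = right_vertex and ?T = top_vertex
  define cells where "cells u = halfway u ` ?G" for u
  define cells2 where "cells2 u v = halfway u ` halfway v ` ?G" for u v
  have G: "?G = cells 0 \<union> cells ?R \<union> cells ?T"
    unfolding cells_def by (rule gasket_decomposition)
  have cells_split: "cells u = cells2 u 0 \<union> cells2 u ?R \<union> cells2 u ?T" for u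
    unfolding cells_def cells2_def
    by (subst gasket_decomposition) (simp add: image_Un)
  have turn_cells: "turn ` cells u = cells (turn u)"
    "turn ` cells2 u v = cells2 (turn u) (turn v)" for u v
    by (simp_all add: cells_def cells2_def turn_halfway_image turn_gasket)
  have three: "(\<Union>k<3. (turn ^^ k) ` P) = P \<union> turn ` P \<union> turn ` turn ` P" for P :: "(real^2) set"
    by (auto simp: numeral_3_eq_3 lessThan_Suc image_image)
  have row: "(*\<^sub>R) s ` n_sierpinski n = (\<Union>j<n. (\<lambda>p. s *\<^sub>R p + (s * real j) *\<^sub>R ?R) ` ?G)" for s
    by (auto simp: n_sierpinski_def image_UN image_image right_vertex_def vec_eq_iff forall_2
        algebra_simps intro!: SUP_cong image_cong)
  have half: "(\<lambda>p. (1/2) *\<^sub>R p) ` ?G = cells 0"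
    "(\<lambda>p. (1/2) *\<^sub>R p + (1/2) *\<^sub>R ?R) ` ?G = cells ?R"
    by (simp_all add: cells_def halfway_def scaleR_add_right)
  have quarter: "(\<lambda>p. (1/4) *\<^sub>R p) ` ?G = cells2 0 0"
    "(\<lambda>p. (1/4) *\<^sub>R p + (1/4) *\<^sub>R ?R) ` ?G = cells2 0 ?R"
    "(\<lambda>p. (1/4) *\<^sub>R p + (1/2) *\<^sub>R ?R) ` ?G = cells2 ?R 0"
    "(\<lambda>p. (1/4) *\<^sub>R p + (3/4) *\<^sub>R ?R) ` ?G = cells2 ?R ?R"
    unfolding cells2_def image_image
    by (intro image_cong refl; simp add: halfway_def vec_eq_iff field_simps)+
  have below: "{..<Suc 0} = {0}" "{..<2::nat} = {0, 1}" "{..<3::nat} = {0, 1, 2}" "{..<4::nat} = {0, 1, 2, 3}"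
    by auto
  consider "n = 1" | "n = 2" | "n = 3" | "n = 4"
    using assms by auto
  then have "\<exists>s. 0 < s \<and> s < 1 \<and> ?G = (\<Union>k<3. (turn ^^ k) ` (*\<^sub>R) s ` n_sierpinski n)"
  proof cases
    case 1
    have P: "(*\<^sub>R) (1/2) ` n_sierpinski n = cells 0"
      using half by (subst row) (simp add: 1 below)
    have "?G = (\<Union>k<3. (turn ^^ k) ` (*\<^sub>R) (1/2) ` n_sierpinski n)"
      unfolding three P turn_cells turn_vertices by (rule G)
    then show ?thesis
      by (intro exI[of _ "1/2"]) simp
  next
    case 2
    have P: "(*\<^sub>R) (1/2) ` n_sierpinski n = cells 0 \<union> cells ?R"
      using half by (subst row) (simp add: 2 below Un_ac)
    have "?G = (\<Union>k<3. (turn ^^ k) ` (*\<^sub>R) (1/2) ` n_sierpinski n)"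
      unfolding three P unfolding image_Un turn_cells turn_vertices by (subst G) (simp only: Un_ac Un_absorb)
    then show ?thesis
      by (intro exI[of _ "1/2"]) simp
  next
    case 3
    have P: "(*\<^sub>R) (1/4) ` n_sierpinski n = cells2 0 0 \<union> cells2 0 ?R \<union> cells2 ?R 0"
      using quarter by (subst row) (simp add: 3 below Un_ac)
    have "?G = (\<Union>k<3. (turn ^^ k) ` (*\<^sub>R) (1/4) ` n_sierpinski n)"
      unfolding three P unfolding image_Un turn_cells turn_vertices
      by (subst G) (simp only: cells_split Un_ac Un_absorb)
    then show ?thesis
      by (intro exI[of _ "1/4"]) simp
  next
    case 4
    have P: "(*\<^sub>R) (1/4) ` n_sierpinski n
        = cells2 0 0 \<union> cells2 0 ?R \<union> cells2 ?R 0 \<union> cells2 ?R ?R"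
      using quarter by (subst row) (simp add: 4 below Un_ac)
    have "?G = (\<Union>k<3. (turn ^^ k) ` (*\<^sub>R) (1/4) ` n_sierpinski n)"
      unfolding three P unfolding image_Un turn_cells turn_vertices
      by (subst G) (simp only: cells_split Un_ac Un_absorb)
    then show ?thesis
      by (intro exI[of _ "1/4"]) simp
  qed
  then show ?thesis
    using that by blast
qed

section \<open>The iterated function system\<close>

lemma rotation_rotation:
  "rotation_matrix \<alpha> *v (rotation_matrix \<beta> *v p) = rotation_matrix (\<alpha> + \<beta>) *v p"
  by (simp add: rotation_matrix_vector vec_eq_iff forall_2 cos_add sin_add algebra_simps)

lemma turn_power:
  "\<exists>w. \<forall>p. (turn ^^ k) p = rotation_matrix (real k * (2 * pi / 3)) *v p + w"
proof (induction k)
  case 0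
  show ?case
    by (intro exI[of _ 0]) (simp add: rotation_matrix_vector vec_eq_iff forall_2)
next
  case (Suc k)
  then obtain w where "\<And>p. (turn ^^ k) p = rotation_matrix (real k * (2 * pi / 3)) *v p + w"
    by blast
  then have "(turn ^^ Suc k) p = rotation_matrix (real (Suc k) * (2 * pi / 3)) *v p + turn w" for p
    by (simp add: turn_def matrix_vector_right_distrib rotation_rotation
        add_divide_distrib distrib_right add.assoc)
  then show ?case
    by blast
qed

lemma turn_power_contractive:
  assumes "k < 3" "0 < s" "s < 1"
  shows "contractive_similitude (\<lambda>p. (turn ^^ k) (s *\<^sub>R p) + v)"
proof -
  obtain w where "\<And>p. (turn ^^ k) p = rotation_matrix (real k * (2 * pi / 3)) *v p + w"
    using turn_power by blast
  then have "(\<lambda>p. (turn ^^ k) (s *\<^sub>R p) + v)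
      = (\<lambda>p. s *\<^sub>R (rotation_matrix (real k * (2 * pi / 3)) *v p) + (w + v))"
    by (simp add: matrix_vector_mult_scaleR add.assoc)
  moreover have "real k * (2 * pi / 3) < 3 * (2 * pi / 3)"
    using assms by (intro mult_strict_right_mono) auto
  ultimately show ?thesis
    using assms rotation_similitude[of s "real k * (2 * pi / 3)"] by simp
qed

lemma compact_n_sierpinski: "compact (n_sierpinski n)"
proof -
  have "compact sierpinski_gasket"
    using compact_invariant_gasket compact_invariant_def by blast
  then show ?thesis
    unfolding n_sierpinski_def
    by (intro compact_UN compact_continuous_image continuous_intros) auto
qed

lemma n_sierpinski_nonempty: "n > 0 \<Longrightarrow> n_sierpinski n \<noteq> {}"
  using compact_invariant_gasket unfolding n_sierpinski_def compact_invariant_def by blast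

theorem mainTheorem2:
  fixes n :: nat
  assumes "n \<in> {1, 2, 3, 4}"
  shows "\<exists>fs. contractive_similitude_ifs fs \<and> is_attractor fs (n_sierpinski n)"
proof -
  obtain s :: real where s: "0 < s" "s < 1"
    and G: "sierpinski_gasket = (\<Union>k<3. (turn ^^ k) ` (*\<^sub>R) s ` n_sierpinski n)"
    using gasket_from_strips[OF assms] .
  have "n > 0"
    using assms by auto
  define g where "g = (\<lambda>(j, k) p. (turn ^^ k) (s *\<^sub>R p) + vector [real j, 0])"
  define fs where "fs = map g (List.product [0..<n] [0..<3])"
  have set_fs: "set fs = g ` ({..<n} \<times> {..<3})"
    by (simp add: fs_def atLeast0LessThan)
  have ifs: "contractive_similitude_ifs fs"
    unfolding contractive_similitude_ifs_def
  proof
    have "g (0, 0) \<in> set fs"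
      using \<open>n > 0\<close> by (auto simp: set_fs)
    then show "fs \<noteq> []"
      by auto
    show "\<forall>f\<in>set fs. contractive_similitude f"
      using turn_power_contractive[OF _ s] by (auto simp: set_fs g_def)
  qed
  have "n_sierpinski n = (\<Union>j<n. \<Union>k<3. g (j, k) ` n_sierpinski n)"
    by (subst n_sierpinski_def, subst G) (simp add: g_def image_UN image_image)
  also have "\<dots> = (\<Union>f\<in>set fs. f ` n_sierpinski n)"
    unfolding set_fs by auto
  finally have "compact_invariant fs (n_sierpinski n)"
    using compact_n_sierpinski n_sierpinski_nonempty[OF \<open>n > 0\<close>]
    unfolding compact_invariant_def by blast
  then show ?thesis
    using ifs is_attractor_iff by blast
qed

end
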